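(* Let $A$ be a vector space with basis $\{e_1,\ldots,e_n\}$ and dual basis $\{e_1^*,\ldots,e_n^*\}$ of $A^*$. Set $r=\sum_{i=1}^n e_i^*\otimes e_i\in(A\oplus A^* )\otimes(A\oplus A^* )$. (a) If $(A,\cdot)$ is an associative algebra, let $D=A\oplus A^*$ be the dialgebra with products $$(x+a^* )\rhd(y+b^* )=x\cdot y-R_{\cdot}^*(x)b^*,\qquad (x+a^* )\lhd(y+b^* )=x\cdot y-L_{\cdot}^*(y)a^*.$$ Then $(D,\rhd,\lhd,\delta_{\rhd,r},\delta_{\lhd,r})$ is a factorizable bi-dialgebra. (b) If $(A,\rhd,\lhd)$ is a dialgebra, let $D=A\oplus A^*$ be the dialgebra with products $$(x+a^* )\rhd(y+b^* )=x\rhd y-R_{\lhd}^*(x)b^*+(L_{\lhd}^*-L_{\rhd}^* )(y)a^*,$$ $$(x+a^* )\lhd(y+b^* )=x\lhd y+(R_{\rhd}^*-R_{\lhd}^* )(x)b^*-L_{\rhd}^*(y)a^*.$$ Then $(D,\rhd,\lhd,\delta_{\rhd,r},\delta_{\lhd,r})$ is a factorizable bi-dialgebra. In both cases, $\delta_{\rhd,r}(u)=(R_{\star}(u)\otimes\mathrm{id}+\mathrm{id}\otimes L_{\lhd}(u))r$ and $\delta_{\lhd,r}(u)=(R_{\rhd}(u)\otimes\mathrm{id}-\mathrm{id}\otimes L_{\star}(u))r$ for $u\in D$, with operators taken in the dialgebra $D$.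
   Context: All vector spaces and algebras are finite-dimensional over a field $\mathbb F$ of characteristic $0$; algebras are not assumed unital. Notation: $x\star y=x\rhd y-x\lhd y$; $L_\diamond(x)y=x\diamond y=R_\diamond(y)x$; $\tau(x\otimes y)=y\otimes x$; for linear $\varphi:A\to\mathrm{End}(V)$, $\varphi^*:A\to\mathrm{End}(V^* )$ is given by $\langle\varphi^*(x)v^*,u\rangle=-\langle v^*,\varphi(x)u\rangle$ (note the sign). **Dialgebra.** $(A,\rhd,\lhd)$ where $\rhd,\lhd$ are associative bilinear products with $(x\lhd y)\lhd z=x\lhd(y\rhd z)$, $(x\rhd y)\lhd z=x\rhd(y\lhd z)$, $(x\lhd y)\rhd z=x\rhd(y\rhd z)$. **Co-dialgebra.** $(D,\delta_{\rhd},\delta_{\lhd})$ with $\delta_{\rhd},\delta_{\lhd}:D\to D\otimes D$ linear and coassociative with $(\mathrm{id}\otimes\delta_{\lhd})\delta_{\lhd}=(\mathrm{id}\otimes\delta_{\rhd})\delta_{\lhd}$, $(\delta_{\rhd}\otimes\mathrm{id})\delta_{\lhd}=(\mathrm{id}\otimes\delta_{\lhd})\delta_{\rhd}$, $(\delta_{\lhd}\otimes\mathrm{id})\delta_{\rhd}=(\delta_{\rhd}\otimes\mathrm{id})\delta_{\rhd}$. **Bi-dialgebra.** $(D,\rhd,\lhd,\delta_{\rhd},\delta_{\lhd})$, a dialgebra and a co-dialgebra such that, with $\delta_\star=\delta_{\rhd}-\delta_{\lhd}$, for all $x,y\in D$: $(\mathrm{id}\otimes L_{\lhd}(x))\delta_{\lhd}(y)=(R_{\rhd}(y)\otimes\mathrm{id})\delta_{\rhd}(x)$;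 $(L_{\lhd}(x)\otimes\mathrm{id})\delta_{\rhd}(y)=(\mathrm{id}\otimes L_{\lhd}(y))\tau\delta_{\rhd}(x)$; $(R_{\rhd}(x)\otimes\mathrm{id})\tau\delta_{\lhd}(y)=(\mathrm{id}\otimes R_{\rhd}(y))\delta_{\lhd}(x)$; $\delta_{\rhd}(x\rhd y)=(\mathrm{id}\otimes L_{\rhd}(x))\delta_{\rhd}(y)-(R_{\star}(y)\otimes\mathrm{id})\delta_{\star}(x)$; $\delta_{\rhd}(x\lhd y)=(\mathrm{id}\otimes L_{\lhd}(x))\delta_{\star}(y)+(R_{\lhd}(y)\otimes\mathrm{id})\delta_{\rhd}(x)$; $\delta_{\lhd}(x\rhd y)=(\mathrm{id}\otimes L_{\star}(x))\delta_{\lhd}(y)+(R_{\rhd}(y)\otimes\mathrm{id})\delta_{\lhd}(x)$; $\delta_{\lhd}(x\lhd y)=(R_{\lhd}(y)\otimes\mathrm{id})\delta_{\lhd}(x)-(\mathrm{id}\otimes L_{\star}(x))\delta_{\star}(y)$; $(L_{\star}(x)\otimes\mathrm{id})\delta_{\rhd}(y)+(\mathrm{id}\otimes L_{\lhd}(y))\tau\delta_{\lhd}(x)=(R_{\star}(y)\otimes\mathrm{id})\tau\delta_{\star}(x)+(\mathrm{id}\otimes R_{\lhd}(x))\delta_{\rhd}(y)$; $(R_{\lhd}(x)\otimes\mathrm{id})\tau\delta_{\lhd}(y)+(\mathrm{id}\otimes R_{\rhd}(y))\delta_{\star}(x)=(L_{\star}(y)\otimes\mathrm{id})\delta_{\star}(x)+(\mathrm{id}\otimes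 L_{\rhd}(x))\tau\delta_{\lhd}(y)$. **Factorizable.** $r=\sum_i a_i\otimes b_i\in D\otimes D$ solves the diassociative Yang-Baxter equation (DAYBE) if $\sum_{i,j}\big(a_i\otimes a_j\otimes b_i\rhd b_j-a_j\otimes a_i\lhd b_j\otimes b_i-a_i\star a_j\otimes b_i\otimes b_j\big)=0$; $s\in D\otimes D$ is invariant if $(R_{\star}(u)\otimes\mathrm{id}+\mathrm{id}\otimes L_{\lhd}(u))s=0=(R_{\rhd}(u)\otimes\mathrm{id}-\mathrm{id}\otimes L_{\star}(u))s$ for all $u\in D$. If $r$ solves the DAYBE and its skew-symmetric part $\alpha=r-\tau(r)$ is invariant, the bi-dialgebra $(D,\rhd,\lhd,\delta_{\rhd,r},\delta_{\lhd,r})$ is called quasi-triangular; it is factorizable if in addition $\widetilde\alpha:D^*\to D$, $\langle\widetilde\alpha(u^* ),v^*\rangle=\langle\alpha,u^*\otimes v^*\rangle$, is a linear isomorphism. *)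

theory Defs
  imports "HOL-Analysis.Product_Vector" "HOL-Library.Function_Algebras"
begin

locale fd_vector_space = vector_space scale
  for scale :: "'f::field_char_0 \<Rightarrow> 'v::ab_group_add \<Rightarrow> 'v" (infixr \<open>*s\<close> 75) +
  assumes finite_dimensional: "\<exists>B. finite_dimensional_vector_space (*s) B"

definition bilinear_product :: "('f::field \<Rightarrow> 'v::ab_group_add \<Rightarrow> 'v) \<Rightarrow> ('v \<Rightarrow> 'v \<Rightarrow> 'v) \<Rightarrow> bool" where
  "bilinear_product s m \<longleftrightarrow>
     (\<forall>x. Vector_Spaces.linear s s (\<lambda>y. m x y)) \<and> (\<forall>y. Vector_Spaces.linear s s (\<lambda>x. m x y))"

definition Lmult :: "('v \<Rightarrow> 'v \<Rightarrow> 'v) \<Rightarrow> 'v \<Rightarrow> 'v \<Rightarrow> 'v" where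
  "Lmult m x = (\<lambda>y. m x y)"

definition Rmult :: "('v \<Rightarrow> 'v \<Rightarrow> 'v) \<Rightarrow> 'v \<Rightarrow> 'v \<Rightarrow> 'v" where
  "Rmult m y = (\<lambda>x. m x y)"


section \<open>Tensor powers of a finite-dimensional vector space\<close>

text \<open>
  For finite-dimensional \<open>V\<close>, the tensor powers \<open>V \<otimes> V\<close> and \<open>V \<otimes> V \<otimes> V\<close> are realised as
  spaces of bilinear and trilinear forms on the dual of \<open>V\<close>; the pure tensor \<open>x \<otimes> y\<close> is the
  form \<open>(f, g) \<mapsto> f x * g y\<close>. The pairing of a tensor \<open>t\<close> with \<open>f \<otimes> g\<close> is then \<open>t f g\<close>.
  Forms are functions that take the value 0 as soon as an argument is not a linear functional,
  so that equality of tensors is equality of functions, and sums and differences of tensors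
  are pointwise.
\<close>

type_synonym ('v, 'f) tensor2 = "('v \<Rightarrow> 'f) \<Rightarrow> ('v \<Rightarrow> 'f) \<Rightarrow> 'f"
type_synonym ('v, 'f) tensor3 = "('v \<Rightarrow> 'f) \<Rightarrow> ('v \<Rightarrow> 'f) \<Rightarrow> ('v \<Rightarrow> 'f) \<Rightarrow> 'f"

definition scale_tensor2 :: "'f::times \<Rightarrow> ('v, 'f) tensor2 \<Rightarrow> ('v, 'f) tensor2" where
  "scale_tensor2 c t = (\<lambda>f g. c * t f g)"

definition flip :: "('v, 'f) tensor2 \<Rightarrow> ('v, 'f) tensor2" (\<open>\<tau>\<close>) where
  "\<tau> t = (\<lambda>f g. t g f)"

context fd_vector_space
begin

definition functionals :: "('v \<Rightarrow> 'f) set" where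
  "functionals = {f. Vector_Spaces.linear (*s) (*) f}"

definition tensor :: "'v \<Rightarrow> 'v \<Rightarrow> ('v, 'f) tensor2" (infix \<open>\<otimes>\<close> 72) where
  "x \<otimes> y = (\<lambda>f g. if f \<in> functionals \<and> g \<in> functionals then f x * g y else 0)"

definition pure_tensor3 :: "'v \<Rightarrow> 'v \<Rightarrow> 'v \<Rightarrow> ('v, 'f) tensor3" where
  "pure_tensor3 x y z = (\<lambda>f g h.
     if f \<in> functionals \<and> g \<in> functionals \<and> h \<in> functionals then f x * g y * h z else 0)"

definition tensor_square :: "('v, 'f) tensor2 set" where
  "tensor_square = {t. \<exists>(n::nat) a b. t = (\<Sum>i<n. a i \<otimes> b i)}"

text \<open>The operators below induce \<open>\<phi> \<otimes> \<psi>\<close>, \<open>id \<otimes> \<delta>\<close> and \<open>\<delta> \<otimes> id\<close> on tensors by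
  precomposition with the transposed maps; see the three lemmas on pure tensors.\<close>

definition tensor_map :: "('v \<Rightarrow> 'v) \<Rightarrow> ('v \<Rightarrow> 'v) \<Rightarrow> ('v, 'f) tensor2 \<Rightarrow> ('v, 'f) tensor2"
    (infix \<open>\<otimes>\<^sub>m\<close> 72) where
  "(\<phi> \<otimes>\<^sub>m \<psi>) t = (\<lambda>f g.
     if f \<in> functionals \<and> g \<in> functionals then t (f \<circ> \<phi>) (g \<circ> \<psi>) else 0)"

definition id_tensor :: "('v \<Rightarrow> ('v, 'f) tensor2) \<Rightarrow> ('v, 'f) tensor2 \<Rightarrow> ('v, 'f) tensor3" where
  "id_tensor \<delta> t = (\<lambda>f g h.
     if f \<in> functionals \<and> g \<in> functionals \<and> h \<in> functionals then t f (\<lambda>y. \<delta> y g h) else 0)"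

definition tensor_id :: "('v \<Rightarrow> ('v, 'f) tensor2) \<Rightarrow> ('v, 'f) tensor2 \<Rightarrow> ('v, 'f) tensor3" where
  "tensor_id \<delta> t = (\<lambda>f g h.
     if f \<in> functionals \<and> g \<in> functionals \<and> h \<in> functionals then t (\<lambda>x. \<delta> x f g) h else 0)"

definition linear_coproduct :: "('v \<Rightarrow> ('v, 'f) tensor2) \<Rightarrow> bool" where
  "linear_coproduct \<delta> \<longleftrightarrow>
     Vector_Spaces.linear (*s) scale_tensor2 \<delta> \<and> (\<forall>x. \<delta> x \<in> tensor_square)"

lemma functional_comp:
  assumes "Vector_Spaces.linear (*s) (*s) \<phi>" "f \<in> functionals"
  shows "f \<circ> \<phi> \<in> functionals"
  using assms unfolding functionals_def by (auto intro: Vector_Spaces.linear_compose)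

lemma tensor_map_pure:
  assumes "Vector_Spaces.linear (*s) (*s) \<phi>" "Vector_Spaces.linear (*s) (*s) \<psi>"
  shows "(\<phi> \<otimes>\<^sub>m \<psi>) (x \<otimes> y) = \<phi> x \<otimes> \<psi> y"
  using assms by (auto simp: tensor_map_def tensor_def functional_comp fun_eq_iff)

lemma coproduct_functional:
  assumes "Vector_Spaces.linear (*s) scale_tensor2 \<delta>"
  shows "(\<lambda>y. \<delta> y g h) \<in> functionals"
proof -
  have add: "\<delta> (x + y) = \<delta> x + \<delta> y" and sc: "\<delta> (c *s x) = scale_tensor2 c (\<delta> x)" for x y c
    using assms by (simp_all add: Vector_Spaces.linear_iff)
  show ?thesis
    unfolding functionals_def mem_Collect_eq Vector_Spaces.linear_iff
    by (auto simp: add sc scale_tensor2_def algebra_simps vector_space_axioms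
        intro!: vector_space.intro)
qed

lemma id_tensor_pure:
  assumes "Vector_Spaces.linear (*s) scale_tensor2 \<delta>"
  shows "id_tensor \<delta> (x \<otimes> y) = (\<lambda>f g h.
    if f \<in> functionals \<and> g \<in> functionals \<and> h \<in> functionals then f x * \<delta> y g h else 0)"
  using assms by (auto simp: id_tensor_def tensor_def coproduct_functional fun_eq_iff)

lemma tensor_id_pure:
  assumes "Vector_Spaces.linear (*s) scale_tensor2 \<delta>"
  shows "tensor_id \<delta> (x \<otimes> y) = (\<lambda>f g h.
    if f \<in> functionals \<and> g \<in> functionals \<and> h \<in> functionals then \<delta> x f g * h y else 0)"
  using assms by (auto simp: tensor_id_def tensor_def coproduct_functional fun_eq_iff)

text \<open>For a bilinear form \<open>\<alpha>\<close> on the dual of a finite-dimensional space, \<open>sharp \<alpha> u\<close> is the unique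
  vector with \<open>\<langle>sharp \<alpha> u, v\<rangle> = \<langle>\<alpha>, u \<otimes> v\<rangle>\<close> for all functionals \<open>v\<close>.\<close>

definition sharp :: "('v, 'f) tensor2 \<Rightarrow> ('v \<Rightarrow> 'f) \<Rightarrow> 'v" where
  "sharp \<alpha> u = (THE x. \<forall>v\<in>functionals. v x = \<alpha> u v)"

definition dual_iso :: "(('v \<Rightarrow> 'f) \<Rightarrow> 'v) \<Rightarrow> bool" where
  "dual_iso T \<longleftrightarrow>
     (\<forall>u\<in>functionals. \<forall>v\<in>functionals. T (u + v) = T u + T v) \<and>
     (\<forall>c. \<forall>u\<in>functionals. T (\<lambda>x. c * u x) = c *s T u) \<and>
     bij_betw T functionals UNIV"

end


section \<open>Dialgebras, co-dialgebras and bi-dialgebras\<close>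

locale associative_algebra = fd_vector_space scale
  for scale :: "'f::field_char_0 \<Rightarrow> 'v::ab_group_add \<Rightarrow> 'v" (infixr \<open>*s\<close> 75) +
  fixes mult :: "'v \<Rightarrow> 'v \<Rightarrow> 'v" (infixl \<open>\<cdot>\<close> 70)
  assumes bilinear: "bilinear_product (*s) (\<cdot>)"
    and assoc: "(x \<cdot> y) \<cdot> z = x \<cdot> (y \<cdot> z)"

locale dialgebra =
  fd_vector_space scale +
  right: associative_algebra scale right_prod + left: associative_algebra scale left_prod
  for scale :: "'f::field_char_0 \<Rightarrow> 'v::ab_group_add \<Rightarrow> 'v" (infixr \<open>*s\<close> 75)
    and right_prod :: "'v \<Rightarrow> 'v \<Rightarrow> 'v" (infixl \<open>\<rhd>\<close> 70)
    and left_prod :: "'v \<Rightarrow> 'v \<Rightarrow> 'v" (infixl \<open>\<lhd>\<close> 70) +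
  assumes lhd_lhd: "(x \<lhd> y) \<lhd> z = x \<lhd> (y \<rhd> z)"
    and rhd_lhd: "(x \<rhd> y) \<lhd> z = x \<rhd> (y \<lhd> z)"
    and lhd_rhd: "(x \<lhd> y) \<rhd> z = x \<rhd> (y \<rhd> z)"
begin

definition star :: "'v \<Rightarrow> 'v \<Rightarrow> 'v" (infixl \<open>\<star>\<close> 70) where
  "x \<star> y = x \<rhd> y - x \<lhd> y"

end

locale co_dialgebra = fd_vector_space scale
  for scale :: "'f::field_char_0 \<Rightarrow> 'v::ab_group_add \<Rightarrow> 'v" (infixr \<open>*s\<close> 75) +
  fixes \<delta>r \<delta>l :: "'v \<Rightarrow> ('v, 'f) tensor2"
  assumes linear_\<delta>r: "linear_coproduct \<delta>r"
    and linear_\<delta>l: "linear_coproduct \<delta>l"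
    and coassoc_\<delta>r: "tensor_id \<delta>r (\<delta>r x) = id_tensor \<delta>r (\<delta>r x)"
    and coassoc_\<delta>l: "tensor_id \<delta>l (\<delta>l x) = id_tensor \<delta>l (\<delta>l x)"
    and co_ll: "id_tensor \<delta>l (\<delta>l x) = id_tensor \<delta>r (\<delta>l x)"
    and co_rl: "tensor_id \<delta>r (\<delta>l x) = id_tensor \<delta>l (\<delta>r x)"
    and co_lr: "tensor_id \<delta>l (\<delta>r x) = tensor_id \<delta>r (\<delta>r x)"
begin

definition \<delta>s :: "'v \<Rightarrow> ('v, 'f) tensor2" where
  "\<delta>s x = \<delta>r x - \<delta>l x"

end

locale bi_dialgebra =
  dialgebra scale right_prod left_prod + co_dialgebra scale \<delta>r \<delta>l
  for scale :: "'f::field_char_0 \<Rightarrow> 'v::ab_group_add \<Rightarrow> 'v" (infixr \<open>*s\<close> 75)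
    and right_prod :: "'v \<Rightarrow> 'v \<Rightarrow> 'v" (infixl \<open>\<rhd>\<close> 70)
    and left_prod :: "'v \<Rightarrow> 'v \<Rightarrow> 'v" (infixl \<open>\<lhd>\<close> 70)
    and \<delta>r \<delta>l :: "'v \<Rightarrow> ('v, 'f) tensor2" +
  assumes bi1: "(id \<otimes>\<^sub>m Lmult (\<lhd>) x) (\<delta>l y) = (Rmult (\<rhd>) y \<otimes>\<^sub>m id) (\<delta>r x)"
    and bi2: "(Lmult (\<lhd>) x \<otimes>\<^sub>m id) (\<delta>r y) = (id \<otimes>\<^sub>m Lmult (\<lhd>) y) (\<tau> (\<delta>r x))"
    and bi3: "(Rmult (\<rhd>) x \<otimes>\<^sub>m id) (\<tau> (\<delta>l y)) = (id \<otimes>\<^sub>m Rmult (\<rhd>) y) (\<delta>l x)"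
    and bi4: "\<delta>r (x \<rhd> y) = (id \<otimes>\<^sub>m Lmult (\<rhd>) x) (\<delta>r y) - (Rmult (\<star>) y \<otimes>\<^sub>m id) (\<delta>s x)"
    and bi5: "\<delta>r (x \<lhd> y) = (id \<otimes>\<^sub>m Lmult (\<lhd>) x) (\<delta>s y) + (Rmult (\<lhd>) y \<otimes>\<^sub>m id) (\<delta>r x)"
    and bi6: "\<delta>l (x \<rhd> y) = (id \<otimes>\<^sub>m Lmult (\<star>) x) (\<delta>l y) + (Rmult (\<rhd>) y \<otimes>\<^sub>m id) (\<delta>l x)"
    and bi7: "\<delta>l (x \<lhd> y) = (Rmult (\<lhd>) y \<otimes>\<^sub>m id) (\<delta>l x) - (id \<otimes>\<^sub>m Lmult (\<star>) x) (\<delta>s y)"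
    and bi8: "(Lmult (\<star>) x \<otimes>\<^sub>m id) (\<delta>r y) + (id \<otimes>\<^sub>m Lmult (\<lhd>) y) (\<tau> (\<delta>l x))
            = (Rmult (\<star>) y \<otimes>\<^sub>m id) (\<tau> (\<delta>s x)) + (id \<otimes>\<^sub>m Rmult (\<lhd>) x) (\<delta>r y)"
    and bi9: "(Rmult (\<lhd>) x \<otimes>\<^sub>m id) (\<tau> (\<delta>l y)) + (id \<otimes>\<^sub>m Rmult (\<rhd>) y) (\<delta>s x)
            = (Lmult (\<star>) y \<otimes>\<^sub>m id) (\<delta>s x) + (id \<otimes>\<^sub>m Lmult (\<rhd>) x) (\<tau> (\<delta>l y))"


section \<open>Factorizable bi-dialgebras\<close>

context dialgebra
begin

text \<open>The value of the left-hand side of the Yang-Baxter equation does not depend on how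
  \<open>r\<close> is written as a sum of pure tensors.\<close>

definition solves_DAYBE :: "('v, 'f) tensor2 \<Rightarrow> bool" where
  "solves_DAYBE r \<longleftrightarrow> r \<in> tensor_square \<and>
     (\<forall>(n::nat) a b. r = (\<Sum>i<n. a i \<otimes> b i) \<longrightarrow>
        (\<Sum>i<n. \<Sum>j<n.
            pure_tensor3 (a i) (a j) (b i \<rhd> b j)
          - pure_tensor3 (a j) (a i \<lhd> b j) (b i)
          - pure_tensor3 (a i \<star> a j) (b i) (b j)) = 0)"

definition invariant :: "('v, 'f) tensor2 \<Rightarrow> bool" where
  "invariant s \<longleftrightarrow>
     (\<forall>u. (Rmult (\<star>) u \<otimes>\<^sub>m id) s + (id \<otimes>\<^sub>m Lmult (\<lhd>) u) s = 0 \<and>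
          (Rmult (\<rhd>) u \<otimes>\<^sub>m id) s - (id \<otimes>\<^sub>m Lmult (\<star>) u) s = 0)"

definition coboundary_r :: "('v, 'f) tensor2 \<Rightarrow> 'v \<Rightarrow> ('v, 'f) tensor2" where
  "coboundary_r r u = (Rmult (\<star>) u \<otimes>\<^sub>m id) r + (id \<otimes>\<^sub>m Lmult (\<lhd>) u) r"

definition coboundary_l :: "('v, 'f) tensor2 \<Rightarrow> 'v \<Rightarrow> ('v, 'f) tensor2" where
  "coboundary_l r u = (Rmult (\<rhd>) u \<otimes>\<^sub>m id) r - (id \<otimes>\<^sub>m Lmult (\<star>) u) r"

definition skew_part :: "('v, 'f) tensor2 \<Rightarrow> ('v, 'f) tensor2" where
  "skew_part r = r - \<tau> r"

definition quasi_triangular_bi_dialgebra :: "('v, 'f) tensor2 \<Rightarrow> bool" where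
  "quasi_triangular_bi_dialgebra r \<longleftrightarrow>
     bi_dialgebra (*s) (\<rhd>) (\<lhd>) (coboundary_r r) (coboundary_l r) \<and>
     solves_DAYBE r \<and> invariant (skew_part r)"

definition factorizable_bi_dialgebra :: "('v, 'f) tensor2 \<Rightarrow> bool" where
  "factorizable_bi_dialgebra r \<longleftrightarrow>
     quasi_triangular_bi_dialgebra r \<and> dual_iso (sharp (skew_part r))"

end


section \<open>Dual spaces\<close>

text \<open>\<open>'b\<close> is (a type of elements for) the dual space of \<open>'a\<close>: the evaluation map \<open>\<langle>v, u\<rangle>\<close>
  identifies \<open>'b\<close> linearly with the space of all linear functionals on \<open>'a\<close>. A set of
  functionals depending on \<open>sA\<close> is not itself a type, whence this indirection.\<close>

locale dual_space = vsA: vector_space sA + vsB: vector_space sB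
  for sA :: "'f::field \<Rightarrow> 'a::ab_group_add \<Rightarrow> 'a"
    and sB :: "'f \<Rightarrow> 'b::ab_group_add \<Rightarrow> 'b" +
  fixes ev :: "'b \<Rightarrow> 'a \<Rightarrow> 'f" (\<open>\<langle>_,/ _\<rangle>\<close>)
  assumes ev_add: "\<langle>v + w, u\<rangle> = \<langle>v, u\<rangle> + \<langle>w, u\<rangle>"
    and ev_scale: "\<langle>sB c v, u\<rangle> = c * \<langle>v, u\<rangle>"
    and ev_bij: "bij_betw ev UNIV {f. Vector_Spaces.linear sA (*) f}"

text \<open>\<open>dual_rep ev \<phi>\<close> is \<open>\<phi>\<^sup>*\<close>, with the sign convention \<open>\<langle>\<phi>\<^sup>*(x) v, u\<rangle> = - \<langle>v, \<phi>(x) u\<rangle>\<close>.\<close>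

definition dual_rep :: "('b \<Rightarrow> 'a \<Rightarrow> 'f::uminus) \<Rightarrow> ('c \<Rightarrow> 'a \<Rightarrow> 'a) \<Rightarrow> 'c \<Rightarrow> 'b \<Rightarrow> 'b" where
  "dual_rep ev \<phi> x v = (THE w. \<forall>u. ev w u = - ev v (\<phi> x u))"

lemma (in dual_space) ev_dual_rep:
  assumes "Vector_Spaces.linear sA sA (\<phi> x)"
  shows "\<langle>dual_rep ev \<phi> x v, u\<rangle> = - \<langle>v, \<phi> x u\<rangle>"
proof -
  have lin: "Vector_Spaces.linear sA (*) (ev v)"
    using ev_bij by (auto simp: bij_betw_def)
  have "Vector_Spaces.linear sA (*) (\<lambda>u. - \<langle>v, \<phi> x u\<rangle>)"
    using lin assms by (auto simp: Vector_Spaces.linear_iff)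
  then obtain w where "ev w = (\<lambda>u. - \<langle>v, \<phi> x u\<rangle>)"
    using ev_bij by (auto simp: bij_betw_def dest!: equalityD2)
  then have "\<exists>!w. \<forall>u. \<langle>w, u\<rangle> = - \<langle>v, \<phi> x u\<rangle>"
    using ev_bij by (auto simp: bij_betw_def fun_eq_iff inj_def)
  from theI'[OF this] show ?thesis by (auto simp: dual_rep_def)
qed

end

theory Submission
  imports Defs
begin

text \<open>
  A functional on \<open>A \<oplus> A\<^sup>*\<close> is a pair of \<open>p \<in> A\<close> and \<open>q \<in> A\<^sup>*\<close>, and on such pairs \<open>r\<close> is the
  evaluation \<open>r((p, q), (p', q')) = \<langle>q', p\<rangle>\<close>. Transposing the multiplication operators of the double
  shows that the two coboundary coproducts of \<open>r\<close> vanish on \<open>A\<close> and are the transposes of \<open>\<rhd>\<close> and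
  \<open>\<lhd>\<close> on \<open>A\<^sup>*\<close>: \<open>\<delta>(x + a)((p, q), (p', q'))\<close> is \<open>\<langle>a, p \<rhd> p'\<rangle>\<close>, respectively \<open>\<langle>a, p \<lhd> p'\<rangle>\<close>. All
  bi-dialgebra identities thereby become identities between triple products in \<open>A\<close>. Contracting \<open>r\<close>
  with \<open>(p, q)\<close> in the first or second factor yields \<open>p\<close> or \<open>q\<close>, which evaluates the Yang-Baxter
  equation for every presentation of \<open>r\<close>; and \<open>r - \<tau> r\<close> induces the isomorphism \<open>(p, q) \<mapsto> (p, - q)\<close>.
\<close>

section \<open>Bilinear products and spanning sets\<close>

lemma bilinear_product_iff:
  "bilinear_product s m \<longleftrightarrow> vector_space s \<and>
    (\<forall>x y z. m (x + y) z = m x z + m y z \<and> m x (y + z) = m x y + m x z) \<and>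
    (\<forall>c x y. m (s c x) y = s c (m x y) \<and> m x (s c y) = s c (m x y))"
  unfolding bilinear_product_def Vector_Spaces.linear_iff by blast

text \<open>Lets a double sum over a presentation of \<open>r\<close> collapse to a single product
  of two contracted vectors in the Yang-Baxter equation.\<close>

lemma bilinear_product_double_sum:
  assumes "bilinear_product s m" "finite I" "finite J"
  shows "m (\<Sum>i\<in>I. s (c i) (x i)) (\<Sum>j\<in>J. s (d j) (y j)) = (\<Sum>i\<in>I. \<Sum>j\<in>J. s (c i * d j) (m (x i) (y j)))"
proof -
  interpret vector_space s using assms(1) by (simp add: bilinear_product_iff)
  interpret l: additive "\<lambda>z. m z w" for w
    using assms(1) by unfold_locales (simp add: bilinear_product_iff)
  interpret r: additive "m z" for z
    using assms(1) by unfold_locales (simp add: bilinear_product_iff)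
  show ?thesis
    using assms(1) unfolding l.sum
    by (simp add: r.sum bilinear_product_iff scale_sum_right mult.commute)
qed

text \<open>A maximal independent subset of \<open>S\<close> is a finite basis. For the double this
  makes it enough to exhibit a finite spanning set, with no proof of independence.\<close>

lemma (in vector_space) finite_dimensional_if_spanned:
  assumes "finite S" "span S = UNIV"
  shows "\<exists>B. finite_dimensional_vector_space scale B"
proof -
  obtain B where B: "B \<subseteq> S" "independent B" "S \<subseteq> span B"
    using maximal_independent_subset by blast
  have "span B = UNIV"
    using B assms(2) span_mono[of S "span B"] by (auto simp: span_span)
  moreover have "finite B" using B assms(1) finite_subset by blast
  ultimately have "finite_dimensional_vector_space scale B"
    using B by unfold_locales auto
  then show ?thesis ..
qed

section \<open>Functionals and finite sums of pure tensors\<close>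

context fd_vector_space
begin

lemma functionals_iff:
  "f \<in> functionals \<longleftrightarrow> (\<forall>x y. f (x + y) = f x + f y) \<and> (\<forall>c x. f (c *s x) = c * f x)"
  unfolding functionals_def mem_Collect_eq Vector_Spaces.linear_iff
  by (auto simp: vector_space_axioms algebra_simps intro!: vector_space.intro)

lemma functional_sum:
  assumes "f \<in> functionals"
  shows "f (sum g I) = (\<Sum>i\<in>I. f (g i))"
proof -
  interpret Vector_Spaces.linear scale "(*)" f using assms by (simp add: functionals_def)
  show ?thesis by (rule sum)
qed

lemma tensor_sum_apply:
  assumes "f \<in> functionals" "g \<in> functionals"
  shows "(\<Sum>i\<in>I. a i \<otimes> b i) f g = (\<Sum>i\<in>I. f (a i) * g (b i))"
  using assms by (induction I rule: infinite_finite_induct) (auto simp: tensor_def)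

lemma tensor_sum_zero:
  assumes "\<not> (f \<in> functionals \<and> g \<in> functionals)"
  shows "(\<Sum>i\<in>I. a i \<otimes> b i) f g = 0"
  using assms by (induction I rule: infinite_finite_induct) (auto simp: tensor_def)

lemma tensor_square_sumI:
  assumes "finite I"
  shows "(\<Sum>i\<in>I. a i \<otimes> b i) \<in> tensor_square"
proof -
  obtain h where h: "bij_betw h {..<card I} I"
    using ex_bij_betw_nat_finite[OF assms] by (auto simp: lessThan_atLeast0)
  have "(\<Sum>i\<in>I. a i \<otimes> b i) = (\<Sum>k<card I. a (h k) \<otimes> b (h k))"
    by (rule sum.reindex_bij_betw[OF h, symmetric])
  then show ?thesis
    unfolding tensor_square_def mem_Collect_eq
    by (intro exI[of _ "card I"] exI[of _ "\<lambda>k. a (h k)"] exI[of _ "\<lambda>k. b (h k)"])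
qed

lemma tensor_square_add:
  assumes "s \<in> tensor_square" "t \<in> tensor_square"
  shows "s + t \<in> tensor_square"
proof -
  obtain n m :: nat and a b c d where
    s: "s = (\<Sum>i<n. a i \<otimes> b i)" and t: "t = (\<Sum>i<m. c i \<otimes> d i)"
    using assms unfolding tensor_square_def by auto
  \<comment> \<open>The disjoint union of the index sets concatenates the two presentations.\<close>
  have "s + t = (\<Sum>i\<in>{..<n} <+> {..<m}. case_sum a c i \<otimes> case_sum b d i)"
    unfolding s t by (simp add: sum.Plus)
  then show ?thesis by (simp add: tensor_square_sumI)
qed

lemma tensor_map_in_tensor_square:
  assumes "Vector_Spaces.linear (*s) (*s) \<phi>" "Vector_Spaces.linear (*s) (*s) \<psi>"
    and "t \<in> tensor_square"
  shows "(\<phi> \<otimes>\<^sub>m \<psi>) t \<in> tensor_square"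
proof -
  obtain n :: nat and a b where t: "t = (\<Sum>i<n. a i \<otimes> b i)"
    using assms unfolding tensor_square_def by auto
  have "(\<phi> \<otimes>\<^sub>m \<psi>) t = (\<Sum>i<n. \<phi> (a i) \<otimes> \<psi> (b i))"
    unfolding t fun_eq_iff tensor_map_def
    using assms(1,2) by (auto simp: tensor_sum_apply tensor_sum_zero functional_comp)
  then show ?thesis by (simp add: tensor_square_sumI)
qed

lemma tensor_square_uminus:
  assumes "t \<in> tensor_square"
  shows "- t \<in> tensor_square"
proof -
  obtain n :: nat and a b where t: "t = (\<Sum>i<n. a i \<otimes> b i)"
    using assms unfolding tensor_square_def by auto
  have "- (a i \<otimes> b i) = (- a i) \<otimes> b i" for i
  proof (intro ext)
    fix f g
    have "f ((- 1) *s a i) = - 1 * f (a i)" if "f \<in> functionals"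
      using that unfolding functionals_iff by blast
    then show "(- (a i \<otimes> b i)) f g = ((- a i) \<otimes> b i) f g"
      by (auto simp: tensor_def)
  qed
  then have "- t = (\<Sum>i<n. (- a i) \<otimes> b i)"
    unfolding t by (simp add: sum_negf[symmetric])
  then show ?thesis by (simp add: tensor_square_sumI)
qed

lemma tensor_square_diff:
  "s \<in> tensor_square \<Longrightarrow> t \<in> tensor_square \<Longrightarrow> s - t \<in> tensor_square"
  using tensor_square_add[OF _ tensor_square_uminus, of s t] by simp

end

section \<open>Dual bases and functionals on the direct sum\<close>

locale dual_bases = dual_space sA sB ev
  for sA :: "'f::field_char_0 \<Rightarrow> 'a::ab_group_add \<Rightarrow> 'a"
    and sB :: "'f \<Rightarrow> 'b::ab_group_add \<Rightarrow> 'b"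
    and ev :: "'b \<Rightarrow> 'a \<Rightarrow> 'f" (\<open>\<langle>_,/ _\<rangle>\<close>) +
  fixes n :: nat and e :: "nat \<Rightarrow> 'a" and e' :: "nat \<Rightarrow> 'b"
  assumes basis: "finite_dimensional_vector_space sA (e ` {1..n})" "inj_on e {1..n}"
    and dual_basis:
      "\<And>i j. i \<in> {1..n} \<Longrightarrow> j \<in> {1..n} \<Longrightarrow> \<langle>e' i, e j\<rangle> = (if i = j then 1 else 0)"
begin

declare One_nat_def [simp del]

lemma linear_ev: "Vector_Spaces.linear sA (*) (ev v)"
  using ev_bij by (auto simp: bij_betw_def)

lemma ev_add_right: "\<langle>v, x + y\<rangle> = \<langle>v, x\<rangle> + \<langle>v, y\<rangle>"
  and ev_scale_right: "\<langle>v, sA c x\<rangle> = c * \<langle>v, x\<rangle>"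
  using linear_ev by (auto simp: Vector_Spaces.linear_iff)

sublocale ev_left: additive "\<lambda>v. \<langle>v, u\<rangle>" for u
  by unfold_locales (rule ev_add)

sublocale ev_right: additive "ev v" for v
  by unfold_locales (rule ev_add_right)

lemmas ev_simps = ev_add ev_scale ev_add_right ev_scale_right
  ev_left.zero ev_left.minus ev_left.diff ev_right.zero ev_right.minus ev_right.diff

lemma ev_eqI:
  assumes "\<And>u. \<langle>v, u\<rangle> = \<langle>w, u\<rangle>"
  shows "v = w"
  using ev_bij assms by (auto simp: bij_betw_def inj_def fun_eq_iff)

text \<open>\<open>x\<close> is some combination of the basis vectors, and pairing it with
  \<open>e' i\<close> reads off the coefficient of \<open>e i\<close>. Injectivity of
  \<open>e\<close> turns the sum over the set of basis vectors into a sum over indices.\<close>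

lemma basis_expansion: "(\<Sum>i=1..n. sA \<langle>e' i, x\<rangle> (e i)) = x"
proof -
  interpret fdA: finite_dimensional_vector_space sA "e ` {1..n}" by (rule basis)
  have "x \<in> vsA.span (e ` {1..n})" using fdA.span_Basis by simp
  then obtain u where "x = (\<Sum>v\<in>e ` {1..n}. sA (u v) v)"
    by (auto simp: vsA.span_finite)
  then have x: "x = (\<Sum>i=1..n. sA (u (e i)) (e i))"
    by (simp add: sum.reindex[OF basis(2)])
  have "\<langle>e' i, x\<rangle> = u (e i)" if "i \<in> {1..n}" for i
  proof -
    have "\<langle>e' i, x\<rangle> = (\<Sum>j=1..n. u (e j) * (if i = j then 1 else 0))"
      unfolding arg_cong[OF x, of "ev (e' i)"] ev_right.sum ev_scale_right
      using that by (intro sum.cong) (simp_all add: dual_basis)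
    also have "\<dots> = u (e i)" using that by (simp add: if_distrib cong: if_cong)
    finally show ?thesis .
  qed
  then have "(\<Sum>i=1..n. sA \<langle>e' i, x\<rangle> (e i)) = (\<Sum>i=1..n. sA (u (e i)) (e i))" by simp
  then show ?thesis using x by simp
qed

text \<open>The coordinates of a vector are its pairings with the \<open>e' i\<close>, so covectors
  separate vectors.\<close>

lemma ev_right_eqI:
  assumes "\<And>v. \<langle>v, x\<rangle> = \<langle>v, y\<rangle>"
  shows "x = y"
proof -
  have "(\<Sum>i=1..n. sA \<langle>e' i, x\<rangle> (e i)) = (\<Sum>i=1..n. sA \<langle>e' i, y\<rangle> (e i))"
    by (simp only: assms)
  then show ?thesis by (simp only: basis_expansion)
qed

text \<open>Both sides agree at every \<open>u\<close>, by expanding \<open>u\<close> in the basis.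
  That the \<open>e' i\<close> span the dual thus follows from the duality relations.\<close>

lemma dual_basis_expansion: "(\<Sum>i=1..n. sB \<langle>v, e i\<rangle> (e' i)) = v"
proof (rule ev_eqI)
  fix u
  have "\<langle>v, u\<rangle> = \<langle>v, \<Sum>i=1..n. sA \<langle>e' i, u\<rangle> (e i)\<rangle>" by (simp add: basis_expansion)
  also have "\<dots> = \<langle>\<Sum>i=1..n. sB \<langle>v, e i\<rangle> (e' i), u\<rangle>"
    by (simp add: ev_right.sum ev_left.sum ev_simps mult.commute)
  finally show "\<langle>\<Sum>i=1..n. sB \<langle>v, e i\<rangle> (e' i), u\<rangle> = \<langle>v, u\<rangle>" ..
qed

sublocale vector_space_prod sA sB by unfold_locales

abbreviation sD :: "'f \<Rightarrow> 'a \<times> 'b \<Rightarrow> 'a \<times> 'b" where "sD \<equiv> scale"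

sublocale D: fd_vector_space sD
proof -
  let ?S = "(\<lambda>i. (e i, 0)) ` {1..n} \<union> (\<lambda>i. (0, e' i)) ` {1..n}"
  have "(x, a) \<in> p.span ?S" for x a
  proof -
    have "(x, a) = (\<Sum>i=1..n. sD \<langle>e' i, x\<rangle> (e i, 0)) + (\<Sum>i=1..n. sD \<langle>a, e i\<rangle> (0, e' i))"
      by (simp add: prod_eq_iff fst_sum snd_sum scale_prod basis_expansion dual_basis_expansion)
    also have "\<dots> \<in> p.span ?S"
      by (intro p.span_add p.span_sum p.span_scale p.span_base) auto
    finally show ?thesis .
  qed
  then have "p.span ?S = UNIV" by auto
  then show "fd_vector_space sD"
    by (intro fd_vector_space.intro fd_vector_space_axioms.intro p.vector_space_axioms
        p.finite_dimensional_if_spanned[of ?S]) auto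
qed

text \<open>The restriction of \<open>f\<close> to the covectors is evaluation at a vector, by
  reflexivity; this is that vector in coordinates. Likewise \<open>fun_cov f\<close> is the
  restriction of \<open>f\<close> to the vectors.\<close>

definition fun_vec :: "('a \<times> 'b \<Rightarrow> 'f) \<Rightarrow> 'a" where
  "fun_vec f = (\<Sum>i=1..n. sA (f (0, e' i)) (e i))"

definition fun_cov :: "('a \<times> 'b \<Rightarrow> 'f) \<Rightarrow> 'b" where
  "fun_cov f = (\<Sum>i=1..n. sB (f (e i, 0)) (e' i))"

definition pairing :: "'a \<Rightarrow> 'b \<Rightarrow> 'a \<times> 'b \<Rightarrow> 'f" where
  "pairing p q = (\<lambda>(y, b). \<langle>q, y\<rangle> + \<langle>b, p\<rangle>)"

lemma pairing_in_functionals [simp]: "pairing p q \<in> D.functionals"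
  by (auto simp: D.functionals_iff pairing_def scale_def ev_simps algebra_simps)

lemma pairing_linear:
  "pairing p q (u + v) = pairing p q u + pairing p q v"
  "pairing p q (sD c u) = c * pairing p q u"
  using pairing_in_functionals[of p q] unfolding D.functionals_iff by blast+

text \<open>By linearity \<open>f\<close> is determined by its values on the \<open>(e i, 0)\<close>
  and \<open>(0, e' i)\<close>, which are the coefficients of \<open>fun_cov f\<close> and
  \<open>fun_vec f\<close>.\<close>

lemma functional_eq_pairing:
  assumes "f \<in> D.functionals"
  shows "f = pairing (fun_vec f) (fun_cov f)"
proof
  have add: "f (x + y) = f x + f y" and scl: "f (sD c x) = c * f x" for x y c
    using assms by (simp_all only: D.functionals_iff)
  fix z :: "'a \<times> 'b"
  obtain y b where z: "z = (y, b)" by fastforce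
  have "(y, b) = (\<Sum>i=1..n. sD \<langle>e' i, y\<rangle> (e i, 0)) + (\<Sum>i=1..n. sD \<langle>b, e i\<rangle> (0, e' i))"
    by (simp add: prod_eq_iff fst_sum snd_sum scale_prod basis_expansion dual_basis_expansion)
  then have "f (y, b) = f ((\<Sum>i=1..n. sD \<langle>e' i, y\<rangle> (e i, 0)) + (\<Sum>i=1..n. sD \<langle>b, e i\<rangle> (0, e' i)))"
    by (rule arg_cong)
  also have "\<dots> = (\<Sum>i=1..n. \<langle>e' i, y\<rangle> * f (e i, 0)) + (\<Sum>i=1..n. \<langle>b, e i\<rangle> * f (0, e' i))"
    by (simp only: add scl D.functional_sum[OF assms])
  also have "\<dots> = pairing (fun_vec f) (fun_cov f) (y, b)"
    by (simp add: pairing_def fun_vec_def fun_cov_def ev_left.sum ev_right.sum ev_simps mult.commute)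
  finally show "f z = pairing (fun_vec f) (fun_cov f) z" by (simp add: z)
qed

lemma pairing_inject [simp]: "pairing p q = pairing p' q' \<longleftrightarrow> p = p' \<and> q = q'"
proof
  assume eq: "pairing p q = pairing p' q'"
  have "\<langle>q, y\<rangle> = \<langle>q', y\<rangle>" for y
    using fun_cong[OF eq, of "(y, 0)"] by (simp add: pairing_def ev_simps)
  moreover have "\<langle>b, p\<rangle> = \<langle>b, p'\<rangle>" for b
    using fun_cong[OF eq, of "(0, b)"] by (simp add: pairing_def ev_simps)
  then have "p = p'" by (rule ev_right_eqI)
  ultimately show "p = p' \<and> q = q'" by (auto intro: ev_eqI)
qed auto

lemma fun_vec_pairing [simp]: "fun_vec (pairing p q) = p"
  and fun_cov_pairing [simp]: "fun_cov (pairing p q) = q"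
  using functional_eq_pairing[OF pairing_in_functionals, of p q] by simp_all

lemma functional_cases:
  assumes "f \<in> D.functionals"
  obtains p q where "f = pairing p q"
  using functional_eq_pairing[OF assms] by blast

lemma pairing_eqI:
  assumes "\<And>p q. pairing p q x = pairing p q y"
  shows "x = y"
proof -
  have "\<langle>q, fst x\<rangle> = \<langle>q, fst y\<rangle>" for q
    using assms[of 0 q] by (simp add: pairing_def ev_simps case_prod_unfold)
  then have "fst x = fst y" by (rule ev_right_eqI)
  moreover have "\<langle>snd x, p\<rangle> = \<langle>snd y, p\<rangle>" for p
    using assms[of p 0] by (simp add: pairing_def ev_simps case_prod_unfold)
  ultimately show ?thesis by (auto simp: prod_eq_iff intro: ev_eqI)
qed

section \<open>The canonical tensor and equality of tensors\<close>

definition canonical_tensor :: "('a \<times> 'b, 'f) tensor2" where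
  "canonical_tensor = (\<Sum>i=1..n. D.tensor (0, e' i) (e i, 0))"

text \<open>The covector \<open>e' i\<close> in the first factor meets only \<open>p\<close>, and
  \<open>e i\<close> in the second meets only \<open>q'\<close>. The basis expansion of
  \<open>p\<close> then eliminates the bases.\<close>

lemma canonical_tensor_pairing:
  "canonical_tensor (pairing p q) (pairing p' q') = \<langle>q', p\<rangle>"
proof -
  have "canonical_tensor (pairing p q) (pairing p' q') = (\<Sum>i=1..n. \<langle>e' i, p\<rangle> * \<langle>q', e i\<rangle>)"
    unfolding canonical_tensor_def
    by (subst D.tensor_sum_apply) (simp_all, simp add: pairing_def ev_simps)
  also have "\<dots> = \<langle>q', \<Sum>i=1..n. sA \<langle>e' i, p\<rangle> (e i)\<rangle>"
    by (simp add: ev_right.sum ev_simps)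
  finally show ?thesis by (simp add: basis_expansion)
qed

lemma canonical_tensor_in_tensor_square: "canonical_tensor \<in> D.tensor_square"
  unfolding canonical_tensor_def by (rule D.tensor_square_sumI) simp

text \<open>Tensors are compared as functions on all arguments, so the values off the functionals
  have to be matched too; in every use both are 0 there.\<close>

lemma tensor2_eqI:
  assumes "\<And>f g. \<not> (f \<in> D.functionals \<and> g \<in> D.functionals) \<Longrightarrow> s f g = t f g"
    and "\<And>p q p' q'. s (pairing p q) (pairing p' q') = t (pairing p q) (pairing p' q')"
  shows "s = t"
proof (intro ext)
  fix f g
  show "s f g = t f g"
  proof (cases "f \<in> D.functionals \<and> g \<in> D.functionals")
    case True
    then show ?thesis using assms(2) by (auto elim!: functional_cases)
  qed (rule assms(1))
qed

lemma tensor3_eqI: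
  assumes "\<And>f g h. \<not> (f \<in> D.functionals \<and> g \<in> D.functionals \<and> h \<in> D.functionals) \<Longrightarrow> s f g h = t f g h"
    and "\<And>p q p' q' p'' q''. s (pairing p q) (pairing p' q') (pairing p'' q'')
      = t (pairing p q) (pairing p' q') (pairing p'' q'')"
  shows "s = t"
proof (intro ext)
  fix f g h
  show "s f g h = t f g h"
  proof (cases "f \<in> D.functionals \<and> g \<in> D.functionals \<and> h \<in> D.functionals")
    case True
    then show ?thesis using assms(2) by (auto elim!: functional_cases)
  qed (rule assms(1))
qed

end

section \<open>The double of a dialgebra and its transposed multiplications\<close>

locale dialgebra_double =
  dual_bases sA sB ev n e e' + A: dialgebra sA rp lp
  for sA :: "'f::field_char_0 \<Rightarrow> 'a::ab_group_add \<Rightarrow> 'a"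
    and sB :: "'f \<Rightarrow> 'b::ab_group_add \<Rightarrow> 'b"
    and ev :: "'b \<Rightarrow> 'a \<Rightarrow> 'f" (\<open>\<langle>_,/ _\<rangle>\<close>)
    and n :: nat and e :: "nat \<Rightarrow> 'a" and e' :: "nat \<Rightarrow> 'b"
    and rp :: "'a \<Rightarrow> 'a \<Rightarrow> 'a" (infixl \<open>\<rhd>\<close> 70)
    and lp :: "'a \<Rightarrow> 'a \<Rightarrow> 'a" (infixl \<open>\<lhd>\<close> 70)
begin

definition double_right :: "'a \<times> 'b \<Rightarrow> 'a \<times> 'b \<Rightarrow> 'a \<times> 'b" where
  "double_right = (\<lambda>(x, a) (y, b). (x \<rhd> y,
     - dual_rep ev (Rmult (\<lhd>)) x b + (dual_rep ev (Lmult (\<lhd>)) y a - dual_rep ev (Lmult (\<rhd>)) y a)))"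

definition double_left :: "'a \<times> 'b \<Rightarrow> 'a \<times> 'b \<Rightarrow> 'a \<times> 'b" where
  "double_left = (\<lambda>(x, a) (y, b). (x \<lhd> y,
     (dual_rep ev (Rmult (\<rhd>)) x b - dual_rep ev (Rmult (\<lhd>)) x b) - dual_rep ev (Lmult (\<rhd>)) y a))"

lemma double_products [simp]:
  "double_right (x, a) (y, b) = (x \<rhd> y,
     - dual_rep ev (Rmult (\<lhd>)) x b + (dual_rep ev (Lmult (\<lhd>)) y a - dual_rep ev (Lmult (\<rhd>)) y a))"
  "double_left (x, a) (y, b) = (x \<lhd> y,
     (dual_rep ev (Rmult (\<rhd>)) x b - dual_rep ev (Rmult (\<lhd>)) x b) - dual_rep ev (Lmult (\<rhd>)) y a)"
  by (simp_all add: double_right_def double_left_def)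

lemma ev_dual_rep_products [simp]:
  "\<langle>dual_rep ev (Rmult (\<rhd>)) x v, u\<rangle> = - \<langle>v, u \<rhd> x\<rangle>"
  "\<langle>dual_rep ev (Rmult (\<lhd>)) x v, u\<rangle> = - \<langle>v, u \<lhd> x\<rangle>"
  "\<langle>dual_rep ev (Lmult (\<rhd>)) x v, u\<rangle> = - \<langle>v, x \<rhd> u\<rangle>"
  "\<langle>dual_rep ev (Lmult (\<lhd>)) x v, u\<rangle> = - \<langle>v, x \<lhd> u\<rangle>"
  using A.right.bilinear A.left.bilinear
  by (subst ev_dual_rep; simp add: bilinear_product_def Lmult_def Rmult_def)+

lemma products_linear:
  "(x + y) \<rhd> z = x \<rhd> z + y \<rhd> z" "x \<rhd> (y + z) = x \<rhd> y + x \<rhd> z"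
  "(x + y) \<lhd> z = x \<lhd> z + y \<lhd> z" "x \<lhd> (y + z) = x \<lhd> y + x \<lhd> z"
  "sA c x \<rhd> y = sA c (x \<rhd> y)" "x \<rhd> sA c y = sA c (x \<rhd> y)"
  "sA c x \<lhd> y = sA c (x \<lhd> y)" "x \<lhd> sA c y = sA c (x \<lhd> y)"
  using A.right.bilinear A.left.bilinear by (simp_all add: bilinear_product_iff)

sublocale rr: additive "\<lambda>y. x \<rhd> y" for x by unfold_locales (rule products_linear)
sublocale rl: additive "\<lambda>x. x \<rhd> y" for y by unfold_locales (rule products_linear)
sublocale lr: additive "\<lambda>y. x \<lhd> y" for x by unfold_locales (rule products_linear)
sublocale ll: additive "\<lambda>x. x \<lhd> y" for y by unfold_locales (rule products_linear)

lemmas product_simps = products_linear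
  rr.minus rr.diff rr.zero rl.minus rl.diff rl.zero
  lr.minus lr.diff lr.zero ll.minus ll.diff ll.zero

lemma left_left: "x \<lhd> (y \<lhd> z) = x \<lhd> (y \<rhd> z)"
  by (metis A.left.assoc A.lhd_lhd)

text \<open>These rules send each triple product to one of \<open>x \<rhd> (y \<rhd> z)\<close>, \<open>x \<rhd> (y \<lhd> z)\<close> and \<open>x \<lhd> (y \<rhd> z)\<close>,
  the normal forms in a dialgebra.\<close>
lemmas dialgebra_simps = A.right.assoc A.lhd_lhd A.rhd_lhd A.lhd_rhd left_left

text \<open>The vector components of the axioms are the axioms of \<open>A\<close>. The covector
  components, evaluated at a vector, compare triple products of \<open>A\<close> paired with one of
  the covectors involved.\<close>

sublocale DD: dialgebra sD double_right double_left
proof unfold_locales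
  show "bilinear_product sD double_right" "bilinear_product sD double_left"
    by (auto simp: bilinear_product_iff p.vector_space_axioms scale_def product_simps
        algebra_simps ev_simps intro!: ev_eqI)
  fix u v w :: "'a \<times> 'b"
  show "double_right (double_right u v) w = double_right u (double_right v w)"
    "double_left (double_left u v) w = double_left u (double_left v w)"
    "double_left (double_left u v) w = double_left u (double_right v w)"
    "double_left (double_right u v) w = double_right u (double_left v w)"
    "double_right (double_left u v) w = double_right u (double_right v w)"
    by (cases u; cases v; cases w;
        auto simp: dialgebra_simps product_simps ev_simps intro!: ev_eqI)+
qed

text \<open>Evaluate at \<open>(y, b)\<close>: the terms containing \<open>b\<close> give the new
  vector, and those containing \<open>y\<close> give the new covector. The new vector never involves
  \<open>a\<close>.\<close>

lemma pairing_transpose: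
  "pairing p q \<circ> Lmult double_right (x, a) = pairing (p \<lhd> x)
     (- dual_rep ev (Lmult (\<rhd>)) x q - dual_rep ev (Rmult (\<rhd>)) p a + dual_rep ev (Rmult (\<lhd>)) p a)"
  "pairing p q \<circ> Lmult double_left (x, a) = pairing (p \<lhd> x - p \<rhd> x)
     (- dual_rep ev (Lmult (\<lhd>)) x q - dual_rep ev (Rmult (\<rhd>)) p a)"
  "pairing p q \<circ> Lmult DD.star (x, a) = pairing (p \<rhd> x)
     (dual_rep ev (Lmult (\<lhd>)) x q - dual_rep ev (Lmult (\<rhd>)) x q + dual_rep ev (Rmult (\<lhd>)) p a)"
  "pairing p q \<circ> Rmult double_right (x, a) = pairing (x \<rhd> p - x \<lhd> p)
     (- dual_rep ev (Rmult (\<rhd>)) x q - dual_rep ev (Lmult (\<lhd>)) p a)"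
  "pairing p q \<circ> Rmult double_left (x, a) = pairing (x \<rhd> p)
     (- dual_rep ev (Rmult (\<lhd>)) x q - dual_rep ev (Lmult (\<lhd>)) p a + dual_rep ev (Lmult (\<rhd>)) p a)"
  "pairing p q \<circ> Rmult DD.star (x, a) = pairing (- (x \<lhd> p))
     (dual_rep ev (Rmult (\<lhd>)) x q - dual_rep ev (Rmult (\<rhd>)) x q - dual_rep ev (Lmult (\<rhd>)) p a)"
  by (auto simp: fun_eq_iff pairing_def Lmult_def Rmult_def DD.star_def ev_simps)

lemma tensor_map_pairing:
  "D.tensor_map \<phi> \<psi> t (pairing p q) (pairing p' q') = t (pairing p q \<circ> \<phi>) (pairing p' q' \<circ> \<psi>)"
  by (simp add: D.tensor_map_def)

lemma tensor_map_zero: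
  "\<not> (f \<in> D.functionals \<and> g \<in> D.functionals) \<Longrightarrow> D.tensor_map \<phi> \<psi> t f g = 0"
  by (auto simp: D.tensor_map_def)

lemma bilinear_product_star: "bilinear_product sD DD.star"
  using DD.right.bilinear DD.left.bilinear
  unfolding bilinear_product_iff DD.star_def
  by (simp add: p.scale_right_diff_distrib del: split_paired_All)

lemma mult_linear:
  "Vector_Spaces.linear sD sD (Lmult double_right u)"
  "Vector_Spaces.linear sD sD (Lmult double_left u)"
  "Vector_Spaces.linear sD sD (Lmult DD.star u)"
  "Vector_Spaces.linear sD sD (Rmult double_right u)"
  "Vector_Spaces.linear sD sD (Rmult double_left u)"
  "Vector_Spaces.linear sD sD (Rmult DD.star u)"
  using DD.right.bilinear DD.left.bilinear bilinear_product_star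
  unfolding bilinear_product_def Lmult_def Rmult_def by blast+

section \<open>The coboundary coproducts of the canonical tensor\<close>

definition dual_coproduct :: "('a \<Rightarrow> 'a \<Rightarrow> 'a) \<Rightarrow> 'a \<times> 'b \<Rightarrow> ('a \<times> 'b, 'f) tensor2" where
  "dual_coproduct m u = (\<lambda>f g. if f \<in> D.functionals \<and> g \<in> D.functionals
     then \<langle>snd u, m (fun_vec f) (fun_vec g)\<rangle> else 0)"

lemma dual_coproduct_pairing [simp]:
  "dual_coproduct m u (pairing p q) (pairing p' q') = \<langle>snd u, m p p'\<rangle>"
  by (simp add: dual_coproduct_def)

lemma dual_coproduct_zero:
  "\<not> (f \<in> D.functionals \<and> g \<in> D.functionals) \<Longrightarrow> dual_coproduct m u f g = 0"
  by (auto simp: dual_coproduct_def)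

text \<open>In \<open>D.id_tensor\<close> and \<open>D.tensor_id\<close> the inner coproduct becomes
  a functional; this identifies it as the pair \<open>(p, 0)\<close> with \<open>p\<close> a product
  in \<open>A\<close>.\<close>

lemma ev_snd_eq_pairing: "(\<lambda>u. \<langle>snd u, p\<rangle>) = pairing p 0"
  by (simp add: pairing_def ev_simps case_prod_unfold)

text \<open>For \<open>u = (x, a)\<close> the two terms are
  \<open>- \<langle>q', x \<lhd> p\<rangle>\<close> and \<open>\<langle>q', x \<lhd> p\<rangle> +
  \<langle>a, p \<rhd> p'\<rangle>\<close>, so everything except the part in \<open>a\<close>
  cancels.\<close>

lemma coboundary_r_canonical_tensor: "DD.coboundary_r canonical_tensor = dual_coproduct (\<rhd>)"
proof (intro ext[of "DD.coboundary_r canonical_tensor"] tensor2_eqI)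
  fix u p q p' q'
  show "DD.coboundary_r canonical_tensor u (pairing p q) (pairing p' q') =
    dual_coproduct (\<rhd>) u (pairing p q) (pairing p' q')"
    by (cases u) (simp add: DD.coboundary_r_def tensor_map_pairing pairing_transpose
        canonical_tensor_pairing ev_simps)
qed (auto simp: DD.coboundary_r_def tensor_map_zero dual_coproduct_zero)

lemma coboundary_l_canonical_tensor: "DD.coboundary_l canonical_tensor = dual_coproduct (\<lhd>)"
proof (intro ext[of "DD.coboundary_l canonical_tensor"] tensor2_eqI)
  fix u p q p' q'
  show "DD.coboundary_l canonical_tensor u (pairing p q) (pairing p' q') =
    dual_coproduct (\<lhd>) u (pairing p q) (pairing p' q')"
    by (cases u) (simp add: DD.coboundary_l_def tensor_map_pairing pairing_transpose
        canonical_tensor_pairing ev_simps)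
qed (auto simp: DD.coboundary_l_def tensor_map_zero dual_coproduct_zero)

lemma dual_coproduct_linear: "Vector_Spaces.linear sD scale_tensor2 (dual_coproduct m)"
  unfolding Vector_Spaces.linear_iff
  by (auto simp: p.vector_space_axioms fun_eq_iff scale_tensor2_def dual_coproduct_def ev_simps
      scale_def algebra_simps intro!: vector_space.intro)

text \<open>Being a finite sum of pure tensors is inherited from \<open>r\<close> through the
  coboundary formula, since tensor products of linear maps preserve the tensor square.\<close>

lemma linear_coproduct_dual_coproduct:
  "D.linear_coproduct (dual_coproduct (\<rhd>))" "D.linear_coproduct (dual_coproduct (\<lhd>))"
proof -
  have "DD.coboundary_r canonical_tensor u \<in> D.tensor_square"
    "DD.coboundary_l canonical_tensor u \<in> D.tensor_square" for u
    unfolding DD.coboundary_r_def DD.coboundary_l_def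
    by (intro D.tensor_square_add D.tensor_square_diff D.tensor_map_in_tensor_square
        mult_linear p.linear_id canonical_tensor_in_tensor_square)+
  then show "D.linear_coproduct (dual_coproduct (\<rhd>))" "D.linear_coproduct (dual_coproduct (\<lhd>))"
    unfolding D.linear_coproduct_def coboundary_r_canonical_tensor coboundary_l_canonical_tensor
    by (auto intro: dual_coproduct_linear)
qed

section \<open>The bi-dialgebra identities\<close>

text \<open>The co-dialgebra axioms are the dialgebra axioms of \<open>A\<close> transposed. In the
  compatibility conditions all terms are covector parts of \<open>u\<close> or \<open>v\<close>
  paired with triple products of \<open>A\<close>, which are compared in normal form.\<close>

lemma bi_dialgebra_double:
  "bi_dialgebra sD double_right double_left (dual_coproduct (\<rhd>)) (dual_coproduct (\<lhd>))"
proof -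
  interpret C: co_dialgebra sD "dual_coproduct (\<rhd>)" "dual_coproduct (\<lhd>)"
    by unfold_locales
      ((rule linear_coproduct_dual_coproduct)
      | (rule tensor3_eqI; auto simp: D.tensor_id_def D.id_tensor_def ev_snd_eq_pairing
          dialgebra_simps))+
  show ?thesis
  proof unfold_locales
    fix u v :: "'a \<times> 'b"
    obtain x a y b where [simp]: "u = (x, a)" "v = (y, b)" by fastforce
    note simps = C.\<delta>s_def tensor_map_pairing tensor_map_zero dual_coproduct_zero pairing_transpose
      flip_def dialgebra_simps product_simps ev_simps
    \<comment> \<open>In the first three conditions both sides vanish, because
      \<open>z \<lhd> (x \<rhd> y - x \<lhd> y)\<close> and
      \<open>(x \<rhd> y - x \<lhd> y) \<rhd> z\<close> are zero in a dialgebra.\<close>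
    show "D.tensor_map id (Lmult double_left u) (dual_coproduct (\<lhd>) v) =
        D.tensor_map (Rmult double_right v) id (dual_coproduct (\<rhd>) u)"
      by (rule tensor2_eqI) (auto simp: simps)
    show "D.tensor_map (Lmult double_left u) id (dual_coproduct (\<rhd>) v) =
        D.tensor_map id (Lmult double_left v) (\<tau> (dual_coproduct (\<rhd>) u))"
      by (rule tensor2_eqI) (auto simp: simps)
    show "D.tensor_map (Rmult double_right u) id (\<tau> (dual_coproduct (\<lhd>) v)) =
        D.tensor_map id (Rmult double_right v) (dual_coproduct (\<lhd>) u)"
      by (rule tensor2_eqI) (auto simp: simps)
    show "dual_coproduct (\<rhd>) (double_right u v) =
        D.tensor_map id (Lmult double_right u) (dual_coproduct (\<rhd>) v)
        - D.tensor_map (Rmult DD.star v) id (C.\<delta>s u)"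
      by (rule tensor2_eqI) (auto simp: simps)
    show "dual_coproduct (\<rhd>) (double_left u v) =
        D.tensor_map id (Lmult double_left u) (C.\<delta>s v)
        + D.tensor_map (Rmult double_left v) id (dual_coproduct (\<rhd>) u)"
      by (rule tensor2_eqI) (auto simp: simps)
    show "dual_coproduct (\<lhd>) (double_right u v) =
        D.tensor_map id (Lmult DD.star u) (dual_coproduct (\<lhd>) v)
        + D.tensor_map (Rmult double_right v) id (dual_coproduct (\<lhd>) u)"
      by (rule tensor2_eqI) (auto simp: simps)
    show "dual_coproduct (\<lhd>) (double_left u v) =
        D.tensor_map (Rmult double_left v) id (dual_coproduct (\<lhd>) u)
        - D.tensor_map id (Lmult DD.star u) (C.\<delta>s v)"
      by (rule tensor2_eqI) (auto simp: simps)
    show "D.tensor_map (Lmult DD.star u) id (dual_coproduct (\<rhd>) v)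
        + D.tensor_map id (Lmult double_left v) (\<tau> (dual_coproduct (\<lhd>) u)) =
        D.tensor_map (Rmult DD.star v) id (\<tau> (C.\<delta>s u))
        + D.tensor_map id (Rmult double_left u) (dual_coproduct (\<rhd>) v)"
      by (rule tensor2_eqI) (auto simp: simps)
    show "D.tensor_map (Rmult double_left u) id (\<tau> (dual_coproduct (\<lhd>) v))
        + D.tensor_map id (Rmult double_right v) (C.\<delta>s u) =
        D.tensor_map (Lmult DD.star v) id (C.\<delta>s u)
        + D.tensor_map id (Lmult double_right u) (\<tau> (dual_coproduct (\<lhd>) v))"
      by (rule tensor2_eqI) (auto simp: simps)
  qed
qed

section \<open>Contractions and the Yang-Baxter equation\<close>

text \<open>Applying a further functional to the left-hand side gives the value of \<open>r\<close>
  at two functionals, which does not depend on the presentation.\<close>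

lemma contract_first:
  assumes "canonical_tensor = (\<Sum>i<k. D.tensor (a i) (b i))"
  shows "(\<Sum>i<k. sD (pairing p q (a i)) (b i)) = (p, 0)"
proof (rule pairing_eqI)
  fix p' q'
  have "pairing p' q' (\<Sum>i<k. sD (pairing p q (a i)) (b i))
      = canonical_tensor (pairing p q) (pairing p' q')"
    unfolding assms D.tensor_sum_apply[OF pairing_in_functionals pairing_in_functionals]
      D.functional_sum[OF pairing_in_functionals]
    by (simp add: pairing_linear)
  then show "pairing p' q' (\<Sum>i<k. sD (pairing p q (a i)) (b i)) = pairing p' q' (p, 0)"
    by (simp add: canonical_tensor_pairing) (simp add: pairing_def ev_simps)
qed

lemma contract_second:
  assumes "canonical_tensor = (\<Sum>i<k. D.tensor (a i) (b i))"
  shows "(\<Sum>i<k. sD (pairing p q (b i)) (a i)) = (0, q)"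
proof (rule pairing_eqI)
  fix p' q'
  have "pairing p' q' (\<Sum>i<k. sD (pairing p q (b i)) (a i))
      = canonical_tensor (pairing p' q') (pairing p q)"
    unfolding assms D.tensor_sum_apply[OF pairing_in_functionals pairing_in_functionals]
      D.functional_sum[OF pairing_in_functionals]
    by (simp add: pairing_linear mult.commute)
  then show "pairing p' q' (\<Sum>i<k. sD (pairing p q (b i)) (a i)) = pairing p' q' (0, q)"
    by (simp add: canonical_tensor_pairing) (simp add: pairing_def ev_simps)
qed

lemma functional_double_sum:
  fixes k l :: nat
  assumes "bilinear_product sD m"
  shows "pairing p q (m (\<Sum>i<k. sD (c i) (x i)) (\<Sum>j<l. sD (d j) (y j)))
    = (\<Sum>i<k. \<Sum>j<l. c i * d j * pairing p q (m (x i) (y j)))"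
  unfolding bilinear_product_double_sum[OF assms finite_lessThan finite_lessThan]
    D.functional_sum[OF pairing_in_functionals]
  by (simp add: pairing_linear)

lemma sum_apply3: "(\<Sum>i\<in>I. t i) f g h = (\<Sum>i\<in>I. t i f g h)"
  for t :: "'i \<Rightarrow> 'x \<Rightarrow> 'y \<Rightarrow> 'z \<Rightarrow> 'w::comm_monoid_add"
  by (induction I rule: infinite_finite_induct) auto

lemma canonical_tensor_solves_DAYBE: "DD.solves_DAYBE canonical_tensor"
  unfolding DD.solves_DAYBE_def
proof (intro conjI allI impI canonical_tensor_in_tensor_square)
  fix k :: nat and a b
  assume r: "canonical_tensor = (\<Sum>i<k. D.tensor (a i) (b i))"
  show "(\<Sum>i<k. \<Sum>j<k. D.pure_tensor3 (a i) (a j) (double_right (b i) (b j))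
      - D.pure_tensor3 (a j) (double_left (a i) (b j)) (b i)
      - D.pure_tensor3 (DD.star (a i) (a j)) (b i) (b j)) = 0" (is "?L = 0")
  proof (rule tensor3_eqI)
    fix p q p' q' p'' q''
    let ?f = "pairing p q" and ?g = "pairing p' q'" and ?h = "pairing p'' q''"
    have "?L ?f ?g ?h = (\<Sum>i<k. \<Sum>j<k. ?f (a i) * ?g (a j) * ?h (double_right (b i) (b j)))
      - (\<Sum>i<k. \<Sum>j<k. ?h (b i) * ?f (a j) * ?g (double_left (a i) (b j)))
      - (\<Sum>i<k. \<Sum>j<k. ?g (b i) * ?h (b j) * ?f (DD.star (a i) (a j)))"
      unfolding sum_apply3 minus_apply D.pure_tensor3_def
      by (simp add: sum_subtractf mult_ac)
    also have "\<dots> = ?h (double_right (p, 0) (p', 0)) - ?g (double_left (0, q'') (p, 0))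
        - ?f (DD.star (0, q') (0, q''))"
      using functional_double_sum[OF DD.right.bilinear, where k = k and l = k, of _ _ "\<lambda>i. ?f (a i)" b "\<lambda>j. ?g (a j)" b]
        functional_double_sum[OF DD.left.bilinear, where k = k and l = k, of _ _ "\<lambda>i. ?h (b i)" a "\<lambda>j. ?f (a j)" b]
        functional_double_sum[OF bilinear_product_star, where k = k and l = k, of _ _ "\<lambda>i. ?g (b i)" a "\<lambda>j. ?h (b j)" a]
      by (simp only: contract_first[OF r] contract_second[OF r])
    \<comment> \<open>The first two terms both equal
      \<open>\<langle>q'', p \<rhd> p'\<rangle>\<close> and cancel; the third is zero because the
      product of two covectors is zero in the double.\<close>
    also have "\<dots> = 0"
      by (simp add: DD.star_def pairing_def ev_simps product_simps)
    finally show "?L ?f ?g ?h = 0 ?f ?g ?h" by simp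
  qed (auto simp: sum_apply3 D.pure_tensor3_def)
qed

section \<open>Invariance and factorizability\<close>

text \<open>The flip of \<open>r\<close> has the same coboundaries as \<open>r\<close>, namely
  \<open>\<langle>a, p \<rhd> p'\<rangle>\<close> and
  \<open>\<langle>a, p \<lhd> p'\<rangle>\<close> for \<open>u = (x, a)\<close>. Those of the
  difference are therefore zero.\<close>

lemma invariant_skew_part: "DD.invariant (DD.skew_part canonical_tensor)"
  unfolding DD.invariant_def
proof (intro allI conjI)
  fix u :: "'a \<times> 'b"
  obtain x a where [simp]: "u = (x, a)" by fastforce
  note simps = DD.skew_part_def flip_def tensor_map_pairing tensor_map_zero pairing_transpose
    canonical_tensor_pairing ev_simps
  show "D.tensor_map (Rmult DD.star u) id (DD.skew_part canonical_tensor)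
      + D.tensor_map id (Lmult double_left u) (DD.skew_part canonical_tensor) = 0"
    by (rule tensor2_eqI) (auto simp: simps)
  show "D.tensor_map (Rmult double_right u) id (DD.skew_part canonical_tensor)
      - D.tensor_map id (Lmult DD.star u) (DD.skew_part canonical_tensor) = 0"
    by (rule tensor2_eqI) (auto simp: simps)
qed

text \<open>The skew part takes the value
  \<open>\<langle>q', p\<rangle> - \<langle>q, p'\<rangle>\<close>, which is
  \<open>pairing p' q'\<close> at \<open>(p, - q)\<close>. Uniqueness holds because functionals
  separate points.\<close>

lemma sharp_skew_part: "D.sharp (DD.skew_part canonical_tensor) (pairing p q) = (p, - q)"
proof -
  have eq: "pairing p' q' (p, - q) = DD.skew_part canonical_tensor (pairing p q) (pairing p' q')"
    for p' q'
    by (simp add: DD.skew_part_def flip_def canonical_tensor_pairing)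
      (simp add: pairing_def ev_simps)
  show ?thesis
    unfolding D.sharp_def
  proof (rule the_equality)
    show "\<forall>v\<in>D.functionals. v (p, - q) = DD.skew_part canonical_tensor (pairing p q) v"
      using eq by (auto elim!: functional_cases)
    fix x
    assume x: "\<forall>v\<in>D.functionals. v x = DD.skew_part canonical_tensor (pairing p q) v"
    show "x = (p, - q)"
    proof (rule pairing_eqI)
      fix p' q'
      show "pairing p' q' x = pairing p' q' (p, - q)"
        using x pairing_in_functionals unfolding eq by blast
    qed
  qed
qed

lemma dual_iso_sharp_skew_part: "D.dual_iso (D.sharp (DD.skew_part canonical_tensor))"
  unfolding D.dual_iso_def
proof (intro conjI ballI allI)
  fix u v
  assume "u \<in> D.functionals" "v \<in> D.functionals"
  then obtain p q p' q' where uv: "u = pairing p q" "v = pairing p' q'"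
    by (metis functional_cases)
  have add: "pairing p q + pairing p' q' = pairing (p + p') (q + q')"
    by (auto simp: pairing_def ev_simps)
  show "D.sharp (DD.skew_part canonical_tensor) (u + v)
    = D.sharp (DD.skew_part canonical_tensor) u + D.sharp (DD.skew_part canonical_tensor) v"
    unfolding uv add sharp_skew_part by simp
next
  fix c u
  assume "u \<in> D.functionals"
  then obtain p q where u: "u = pairing p q" by (metis functional_cases)
  have scl: "(\<lambda>x. c * pairing p q x) = pairing (sA c p) (sB c q)"
    by (auto simp: pairing_def ev_simps algebra_simps)
  show "D.sharp (DD.skew_part canonical_tensor) (\<lambda>x. c * u x)
    = sD c (D.sharp (DD.skew_part canonical_tensor) u)"
    unfolding u scl sharp_skew_part by (simp add: scale_def)
next
  show "bij_betw (D.sharp (DD.skew_part canonical_tensor)) D.functionals UNIV"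
    by (rule bij_betw_byWitness[where f' = "\<lambda>(p, q). pairing p (- q)"])
      (auto simp: sharp_skew_part elim!: functional_cases)
qed

lemma factorizable_double: "DD.factorizable_bi_dialgebra canonical_tensor"
  unfolding DD.factorizable_bi_dialgebra_def DD.quasi_triangular_bi_dialgebra_def
    coboundary_r_canonical_tensor coboundary_l_canonical_tensor
  by (intro conjI bi_dialgebra_double canonical_tensor_solves_DAYBE invariant_skew_part
      dual_iso_sharp_skew_part)

end

text \<open>With equal products, the double of (b) is the double of (a).\<close>
lemma (in associative_algebra) dialgebra_same_products: "dialgebra scale mult mult"
  by unfold_locales (simp_all add: assoc)

section \<open>Doubles of associative algebras and of dialgebras\<close>

theorem corollary4p29:
  fixes sA :: "'f::field_char_0 \<Rightarrow> 'a::ab_group_add \<Rightarrow> 'a"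
    and sB :: "'f \<Rightarrow> 'b::ab_group_add \<Rightarrow> 'b"
    and ev :: "'b \<Rightarrow> 'a \<Rightarrow> 'f"
    and n :: nat and e :: "nat \<Rightarrow> 'a" and e' :: "nat \<Rightarrow> 'b"
    and sD :: "'f \<Rightarrow> 'a \<times> 'b \<Rightarrow> 'a \<times> 'b"
    and r :: "('a \<times> 'b, 'f) tensor2"
  assumes basis: "finite_dimensional_vector_space sA (e ` {1..n})" "inj_on e {1..n}"
    and dual: "dual_space sA sB ev"
    and dual_basis:
      "\<And>i j. i \<in> {1..n} \<Longrightarrow> j \<in> {1..n} \<Longrightarrow> ev (e' i) (e j) = (if i = j then 1 else 0)"
    and sD: "sD = module_prod.scale sA sB"
    and r: "r = (\<Sum>i=1..n. fd_vector_space.tensor sD (0, e' i) (e i, 0))"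
  shows
    "(\<forall>mult. associative_algebra sA mult \<longrightarrow>
        dialgebra.factorizable_bi_dialgebra sD
          (\<lambda>(x, a) (y, b). (mult x y, - dual_rep ev (Rmult mult) x b))
          (\<lambda>(x, a) (y, b). (mult x y, - dual_rep ev (Lmult mult) y a))
          r)
     \<and>
     (\<forall>rp lp. dialgebra sA rp lp \<longrightarrow>
        dialgebra.factorizable_bi_dialgebra sD
          (\<lambda>(x, a) (y, b). (rp x y,
             - dual_rep ev (Rmult lp) x b
             + (dual_rep ev (Lmult lp) y a - dual_rep ev (Lmult rp) y a)))
          (\<lambda>(x, a) (y, b). (lp x y,
             (dual_rep ev (Rmult rp) x b - dual_rep ev (Rmult lp) x b)
             - dual_rep ev (Lmult rp) y a))
          r)"
proof -
  interpret dual_bases sA sB ev n e e'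
    using dual by (intro dual_bases.intro dual_bases_axioms.intro basis dual_basis)
  have dialgebra_case: "dialgebra.factorizable_bi_dialgebra sD
      (\<lambda>(x, a) (y, b). (rp x y,
         - dual_rep ev (Rmult lp) x b
         + (dual_rep ev (Lmult lp) y a - dual_rep ev (Lmult rp) y a)))
      (\<lambda>(x, a) (y, b). (lp x y,
         (dual_rep ev (Rmult rp) x b - dual_rep ev (Rmult lp) x b)
         - dual_rep ev (Lmult rp) y a))
      r"
    if "dialgebra sA rp lp" for rp lp
  proof -
    interpret dialgebra_double sA sB ev n e e' rp lp
      using that by (intro dialgebra_double.intro dual_bases_axioms)
    show ?thesis
      using factorizable_double
      by (simp only: sD r canonical_tensor_def double_right_def double_left_def)
  qed
  moreover have "dialgebra.factorizable_bi_dialgebra sD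
      (\<lambda>(x, a) (y, b). (mult x y, - dual_rep ev (Rmult mult) x b))
      (\<lambda>(x, a) (y, b). (mult x y, - dual_rep ev (Lmult mult) y a))
      r"
    if "associative_algebra sA mult" for mult
    \<comment> \<open>For equal products the differences of dual representations in (b) vanish,
      which leaves the products of (a).\<close>
    using dialgebra_case[OF associative_algebra.dialgebra_same_products[OF that]] by simp
  ultimately show ?thesis by blast
qed

end
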